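(* Let $p > 0$ and $q < 0$ be integers, and consider the diophantine equation $$x^2 - pxy + y^2 = q .$$ (i) If $3-p \le q < 0$, then the equation has no solutions $(x,y) \in \mathbb{Z}^2$. (ii) If $q = 2-p$ (so that $p \ge 3$, since $q<0$), then the integral solutions of the equation are exactly the points of the two-sided chain $$ \cdots \stackrel{\flat}{\longrightarrow} (1,1) \stackrel{\sharp}{\longrightarrow} (1,p-1) \stackrel{\flat}{\longrightarrow} (p^2-p-1,p-1) \stackrel{\sharp}{\longrightarrow} (p^2-p-1,\,p^3-p^2-2p+1) \stackrel{\flat}{\longrightarrow} \cdots $$ together with the corresponding points in the third quadrant, i.e. the points $(-x,-y)$ with $(x,y)$ in the chain.
   Context: For an integral point $(a,b)$ on the conic $x^2 - pxy + y^2 = q$, Vieta jumping is given by the two involutions $\sharp(a,b) = (a, pa-b)$ and $\flat(a,b) = (pb-a, b)$, both of which map integral points of the conic to integral points of the conic. The two-sided chain in the claim is the set of all points obtained from $(1,1)$ by applying $\sharp$ and $\flat$ alternately, starting with $\sharp$ (the part to the right of $(1,1)$) or starting with $\flat$ (the part to the left of $(1,1)$, which begins, moving leftwards, with $(p-1,1)$, $(p-1,p^2-p-1)$, ...). *)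

theory Defs
  imports Main
begin

definition conic :: "int \<Rightarrow> int \<Rightarrow> (int \<times> int) set" where
  "conic p q = {(x, y). x^2 - p * x * y + y^2 = q}"

definition vieta_sharp :: "int \<Rightarrow> int \<times> int \<Rightarrow> int \<times> int" where
  "vieta_sharp p = (\<lambda>(a, b). (a, p * a - b))"

definition vieta_flat :: "int \<Rightarrow> int \<times> int \<Rightarrow> int \<times> int" where
  "vieta_flat p = (\<lambda>(a, b). (p * b - a, b))"

text \<open>\<open>alternate f g z n\<close> is the result of applying \<open>n\<close> maps to \<open>z\<close> in the order
  \<open>f, g, f, g, \<dots>\<close>\<close>

primrec alternate :: "('a \<Rightarrow> 'a) \<Rightarrow> ('a \<Rightarrow> 'a) \<Rightarrow> 'a \<Rightarrow> nat \<Rightarrow> 'a" where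
  "alternate f g z 0 = z"
| "alternate f g z (Suc n) = (if even n then f else g) (alternate f g z n)"

definition vieta_chain :: "int \<Rightarrow> (int \<times> int) set" where
  "vieta_chain p =
     range (alternate (vieta_sharp p) (vieta_flat p) (1, 1)) \<union>
     range (alternate (vieta_flat p) (vieta_sharp p) (1, 1))"

lemma vieta_chain_right_start:
  "alternate (vieta_sharp p) (vieta_flat p) (1, 1) 1 = (1, p - 1)"
  "alternate (vieta_sharp p) (vieta_flat p) (1, 1) 2 = (p^2 - p - 1, p - 1)"
  "alternate (vieta_sharp p) (vieta_flat p) (1, 1) 3 = (p^2 - p - 1, p^3 - p^2 - 2 * p + 1)"
  by (simp_all add: eval_nat_numeral vieta_sharp_def vieta_flat_def algebra_simps)

lemma vieta_chain_left_start:
  "alternate (vieta_flat p) (vieta_sharp p) (1, 1) 1 = (p - 1, 1)"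
  "alternate (vieta_flat p) (vieta_sharp p) (1, 1) 2 = (p - 1, p^2 - p - 1)"
  by (simp_all add: eval_nat_numeral vieta_sharp_def vieta_flat_def algebra_simps)

end

theory Submission
  imports Defs
begin

text \<open>
  The proof is Fermat descent by Vieta jumping. Since \<open>q < 0\<close>, the equation gives \<open>p x y > 0\<close>, so
  every solution lies in the open first or third quadrant, and by the symmetry
  \<open>(x, y) \<mapsto> (-x, -y)\<close> the first quadrant suffices. Both involutions keep a solution there, because
  \<open>y\<close> and \<open>p x - y\<close> are the two roots of a quadratic with positive product \<open>x\<^sup>2 - q\<close>
  (\<open>vieta_sharp_positive_conic\<close>). Hence a coordinate may be replaced by the other root
  as often as this decreases it, and the process must stop.

  Suppose it stops at \<open>(x, y)\<close> with \<open>0 < x \<le> y\<close>. Stopping means \<open>y \<le> p x - y\<close>, so \<open>y\<close> lies in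
  \<open>[x, p x / 2]\<close>, where \<open>t \<mapsto> x\<^sup>2 - p x t + t\<^sup>2\<close> is decreasing; thus \<open>q \<le> (2 - p) x\<^sup>2 \<le> 2 - p\<close>.
  For \<open>q \<ge> 3 - p\<close> this is absurd, so there are no solutions. For \<open>q = 2 - p\<close> equality must hold
  throughout, which leaves only \<open>(1, 1)\<close> (\<open>no_descent_imp_one_one\<close>). Undoing the descent
  expresses any solution in the first quadrant as an image of \<open>(1, 1)\<close> under a word in the two
  involutions. Repeated letters cancel, so alternating words suffice, and these give the chain
  (\<open>alternate_orbit_closed\<close>).
\<close>

section \<open>Orbits of two involutions\<close>

text \<open>
  Applying \<open>f\<close> to a point of either half of the two-sided orbit moves one step along it:
  outwards if \<open>f\<close> is the next map due there, and inwards if \<open>f\<close> was the last map applied, since it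
  then cancels. The two halves meet in \<open>z\<close>, where \<open>f\<close> leads from one to the other.
\<close>

lemma alternate_orbit_closed:
  assumes inv: "\<And>u. f (f u) = u"
    and u: "u \<in> range (alternate f g z) \<union> range (alternate g f z)"
  shows "f u \<in> range (alternate f g z) \<union> range (alternate g f z)"
proof -
  consider n where "u = alternate f g z n" | n where "u = alternate g f z n"
    using u by blast
  then show ?thesis
  proof cases
    case 1
    show ?thesis
    proof (cases "even n")
      case True
      then have "f u = alternate f g z (Suc n)" using 1 by simp
      then show ?thesis by blast
    next
      case False
      then obtain m where "n = Suc m" "even m" by (cases n) auto
      then have "f u = alternate f g z m" using 1 inv by simp
      then show ?thesis by blast
    qed
  next
    case 2
    show ?thesis
    proof (cases n)
      case 0
      then have "f u = alternate f g z (Suc 0)" using 2 by simp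
      then show ?thesis by blast
    next
      case (Suc m)
      show ?thesis
      proof (cases "even m")
        case True
        then have "f u = alternate g f z (Suc n)" using 2 Suc by simp
        then show ?thesis by blast
      next
        case False
        then have "f u = alternate g f z m" using 2 Suc inv by simp
        then show ?thesis by blast
      qed
    qed
  qed
qed

lemma alternate_invariant:
  assumes "P z" and "\<And>u. P u \<Longrightarrow> P (f u)" and "\<And>u. P u \<Longrightarrow> P (g u)"
  shows "P (alternate f g z n)"
  using assms by (induction n) auto

section \<open>Vieta jumping on the conic\<close>

lemma vieta_sharp_involution: "vieta_sharp p (vieta_sharp p u) = u"
  by (simp add: vieta_sharp_def split: prod.split)

lemma vieta_flat_involution: "vieta_flat p (vieta_flat p u) = u"
  by (simp add: vieta_flat_def split: prod.split)

lemma vieta_sharp_chain: "u \<in> vieta_chain p \<Longrightarrow> vieta_sharp p u \<in> vieta_chain p"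
  unfolding vieta_chain_def by (rule alternate_orbit_closed[OF vieta_sharp_involution])

lemma vieta_flat_chain: "u \<in> vieta_chain p \<Longrightarrow> vieta_flat p u \<in> vieta_chain p"
  unfolding vieta_chain_def
  using alternate_orbit_closed[of "vieta_flat p", OF vieta_flat_involution] by blast

definition positive_conic :: "int \<Rightarrow> int \<Rightarrow> (int \<times> int) set" where
  "positive_conic p q = {(x, y) \<in> conic p q. 0 < x \<and> 0 < y}"

lemma positive_conic_iff:
  "(x, y) \<in> positive_conic p q \<longleftrightarrow> x^2 - p * x * y + y^2 = q \<and> 0 < x \<and> 0 < y"
  by (auto simp: positive_conic_def conic_def)

lemma positive_conic_swap: "(x, y) \<in> positive_conic p q \<longleftrightarrow> (y, x) \<in> positive_conic p q"
  by (auto simp: positive_conic_iff algebra_simps)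

lemma conic_uminus: "(- x, - y) \<in> conic p q \<longleftrightarrow> (x, y) \<in> conic p q"
  by (simp add: conic_def)

lemma conic_quadrants:
  assumes "p > 0" and "q < 0" and "(x, y) \<in> conic p q"
  shows "(x, y) \<in> positive_conic p q \<or> (- x, - y) \<in> positive_conic p q"
proof -
  have "p * (x * y) = x^2 + y^2 - q"
    using assms(3) by (simp add: conic_def algebra_simps)
  also have "\<dots> > 0"
    using assms(2) zero_le_power2[of x] zero_le_power2[of y] by linarith
  finally have "x * y > 0"
    using assms(1) zero_less_mult_pos by blast
  then have "(0 < x \<and> 0 < y) \<or> (x < 0 \<and> y < 0)"
    by (simp add: zero_less_mult_iff)
  then show ?thesis
    using assms(3) conic_uminus[of x y p q] by (auto simp: positive_conic_def)
qed

text \<open>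
  By Vieta, \<open>y (p x - y) = x\<^sup>2 - q\<close>, which is positive; so the second root has the sign of \<open>y\<close>.
\<close>

lemma vieta_sharp_positive_conic:
  assumes "q < 0" and "u \<in> positive_conic p q"
  shows "vieta_sharp p u \<in> positive_conic p q"
proof -
  obtain x y where u: "u = (x, y)" by (cases u)
  have eq: "x^2 - p * x * y + y^2 = q" and pos: "0 < x" "0 < y"
    using assms(2) by (auto simp: u positive_conic_iff)
  have "y * (p * x - y) = x^2 - q"
    using eq by (simp add: algebra_simps power2_eq_square)
  also have "\<dots> > 0"
    using assms(1) zero_le_power2[of x] by linarith
  finally have "0 < p * x - y"
    using pos(2) zero_less_mult_pos by blast
  moreover have "x^2 - p * x * (p * x - y) + (p * x - y)^2 = q"
    using eq by (simp add: algebra_simps power2_eq_square)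
  ultimately show ?thesis
    using pos by (simp add: u vieta_sharp_def positive_conic_iff)
qed

lemma vieta_flat_positive_conic:
  assumes "q < 0" and "u \<in> positive_conic p q"
  shows "vieta_flat p u \<in> positive_conic p q"
proof -
  obtain x y where u: "u = (x, y)" by (cases u)
  have "vieta_sharp p (y, x) \<in> positive_conic p q"
    using assms vieta_sharp_positive_conic positive_conic_swap u by blast
  then show ?thesis
    using positive_conic_swap by (simp add: u vieta_sharp_def vieta_flat_def)
qed

lemma vieta_chain_subset_positive_conic:
  assumes "2 - p < 0"
  shows "vieta_chain p \<subseteq> positive_conic p (2 - p)"
proof -
  have start: "(1, 1) \<in> positive_conic p (2 - p)"
    by (simp add: positive_conic_iff)
  show ?thesis
    unfolding vieta_chain_def
    using alternate_invariant[where P = "\<lambda>u. u \<in> positive_conic p (2 - p)", OF start]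
      vieta_sharp_positive_conic[OF assms] vieta_flat_positive_conic[OF assms]
    by blast
qed

section \<open>Descent\<close>

text \<open>
  On \<open>[x, p x / 2]\<close> the polynomial \<open>x\<^sup>2 - p x t + t\<^sup>2\<close> is largest at \<open>t = x\<close>, with value
  \<open>(2 - p) x\<^sup>2 \<le> 2 - p\<close>. The hypothesis \<open>2 - p \<le> q\<close> therefore forces equality everywhere:
  first \<open>q = 2 - p\<close> and \<open>x = 1\<close>, and then \<open>(y - 1) (y + 1 - p) = 0\<close>, whose root \<open>p - 1\<close>
  exceeds \<open>p / 2\<close>.
\<close>

lemma no_descent_imp_one_one:
  assumes "q < 0" and "2 - p \<le> q" and "(x, y) \<in> positive_conic p q"
    and "x \<le> y" and stop: "y \<le> p * x - y"
  shows "q = 2 - p \<and> x = 1 \<and> y = 1"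
proof -
  have eq: "x^2 - p * x * y + y^2 = q" and pos: "0 < x" "0 < y"
    using assms(3) by (auto simp: positive_conic_iff)
  have p: "p > 2" using assms(1,2) by linarith
  have split: "(p - 2) * x^2 + (y - x) * (p * x - x - y) = - q"
    using eq by (simp add: algebra_simps power2_eq_square)
  have "0 \<le> (y - x) * (p * x - x - y)"
    using assms(4) stop by (intro mult_nonneg_nonneg) auto
  then have "(p - 2) * x^2 \<le> p - 2"
    using split assms(2) by linarith
  then have "x^2 \<le> 1"
    using p by (simp add: mult_le_cancel_left1)
  then have x: "x = 1"
    using pos(1) power2_le_iff_abs_le[of 1 x] by simp
  have rest: "(y - 1) * (p - 1 - y) = - q - (p - 2)"
    using split x by simp
  have gap: "0 < p - 1 - y"
    using stop p unfolding x by simp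
  have "(y - 1) * (p - 1 - y) \<le> 0"
    using rest assms(2) by linarith
  then have "y \<le> 1"
    using gap by (simp add: mult_le_0_iff)
  then have y: "y = 1" using pos(2) by linarith
  then show ?thesis using rest x by simp
qed

text \<open>
  Both parts of the classification in one induction: a solution in the first quadrant descends to
  a point where no descent is possible, which exists only for \<open>q = 2 - p\<close>; since the involutions
  preserve the chain, membership travels back up the descent.
\<close>

lemma positive_conic_descent:
  assumes "q < 0" and "2 - p \<le> q" and "(x, y) \<in> positive_conic p q"
  shows "q = 2 - p \<and> (x, y) \<in> vieta_chain p"
  using assms(3)
proof (induction "nat (x + y)" arbitrary: x y rule: less_induct)
  case less
  have pos: "0 < x" "0 < y"
    using less.prems by (auto simp: positive_conic_iff)
  have "(1, 1) = alternate (vieta_sharp p) (vieta_flat p) (1, 1) 0" by simp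
  then have base: "(1, 1) \<in> vieta_chain p"
    unfolding vieta_chain_def by blast
  consider (stop) "x \<le> y" "y \<le> p * x - y" | (stop') "y \<le> x" "x \<le> p * y - x"
    | (sharp) "p * x - y < y" | (flat) "p * y - x < x"
    by linarith
  then show ?case
  proof cases
    case stop
    then show ?thesis
      using no_descent_imp_one_one[OF assms(1,2) less.prems] base by simp
  next
    case stop'
    then show ?thesis
      using no_descent_imp_one_one[OF assms(1,2)] less.prems positive_conic_swap base by blast
  next
    case sharp
    have mem: "(x, p * x - y) \<in> positive_conic p q"
      using vieta_sharp_positive_conic[OF assms(1) less.prems] by (simp add: vieta_sharp_def)
    have "nat (x + (p * x - y)) < nat (x + y)"
      using sharp pos by linarith
    then have IH: "q = 2 - p \<and> (x, p * x - y) \<in> vieta_chain p"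
      using less.hyps mem by blast
    then show ?thesis
      using vieta_sharp_chain[of "(x, p * x - y)" p] by (simp add: vieta_sharp_def)
  next
    case flat
    have mem: "(p * y - x, y) \<in> positive_conic p q"
      using vieta_flat_positive_conic[OF assms(1) less.prems] by (simp add: vieta_flat_def)
    have "nat ((p * y - x) + y) < nat (x + y)"
      using flat pos by linarith
    then have IH: "q = 2 - p \<and> (p * y - x, y) \<in> vieta_chain p"
      using less.hyps mem by blast
    then show ?thesis
      using vieta_flat_chain[of "(p * y - x, y)" p] by (simp add: vieta_flat_def)
  qed
qed

theorem theorem7:
  fixes p q :: int
  assumes "p > 0" and "q < 0"
  shows "(3 - p \<le> q \<longrightarrow> conic p q = {}) \<and>
         (q = 2 - p \<longrightarrow>
            p \<ge> 3 \<and>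
            conic p q = vieta_chain p \<union> (\<lambda>(x, y). (- x, - y)) ` vieta_chain p)"
proof (intro conjI impI)
  assume q: "3 - p \<le> q"
  have "(x, y) \<notin> conic p q" for x y
  proof
    assume "(x, y) \<in> conic p q"
    then have "q = 2 - p"
      using conic_quadrants[OF assms] positive_conic_descent[OF assms(2)] q by fastforce
    then show False using q by simp
  qed
  then show "conic p q = {}" by auto
next
  assume "q = 2 - p"
  then show "p \<ge> 3" using assms(2) by simp
next
  assume q: "q = 2 - p"
  have chain: "vieta_chain p \<subseteq> conic p q"
    using vieta_chain_subset_positive_conic[of p] assms(2) q by (auto simp: positive_conic_def)
  show "conic p q = vieta_chain p \<union> (\<lambda>(x, y). (- x, - y)) ` vieta_chain p"
  proof (intro equalityI subsetI)
    fix u assume "u \<in> conic p q"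
    moreover obtain x y where u: "u = (x, y)" by (cases u)
    ultimately have "(x, y) \<in> vieta_chain p \<or> (- x, - y) \<in> vieta_chain p"
      using conic_quadrants[OF assms] positive_conic_descent[OF assms(2)] q by blast
    then show "u \<in> vieta_chain p \<union> (\<lambda>(x, y). (- x, - y)) ` vieta_chain p"
      using u by force
  next
    fix u assume "u \<in> vieta_chain p \<union> (\<lambda>(x, y). (- x, - y)) ` vieta_chain p"
    then show "u \<in> conic p q"
      using chain conic_uminus by auto
  qed
qed

end
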